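(* Let $k\ge3$ and let $\{S_n\}$ be a perturbed sequence of weak shifts of degree $d$ corresponding to a uniformly bounded sequence of weak shift-like maps of degree $\tilde d\le d-2$. Let $\tilde G=\lim_{n\to\infty}d^{-n}\log^+\|S(n)(z)\|_{\sup}$ on $U^+$ (the limit exists locally uniformly on $U^+$), and define $G=\tilde G$ on $U^+$ and $G=0$ on $\mathbb{C}^k\setminus U^+$. Then $G$ is continuous, non-constant and plurisubharmonic on $\mathbb{C}^k$.
   Context: Let $Q_m(z)=z^m$ and $\mathbf H_d(w_1,\dots,w_{k-1})=\sum_{i=1}^{k-1}w_i^d$. A uniformly bounded sequence of weak shift-like maps of degree $\tilde d\ge1$ is a sequence $\mathsf S_n(z)=(z_2,\dots,z_k,a_nz_1+p_n(z_2,\dots,z_k))$ with $\deg(a_nz_1+p_n)=\tilde d$, $p_n=\sum_i\alpha_{i,n}\mathbf z^i$, and constants $\tilde m,\tilde M>0$ with $\tilde m<|a_n|<\tilde M$, $|\alpha_{i,n}|<\tilde M$. The associated perturbed sequence of weak shifts of degree $d\ge\tilde d+2$ is $S_n(z)=\mathsf S_n(z)+(0,\dots,0,Q_{d-1}(z_2),\mathbf H_d(z_2,\dots,z_k))$. $S(n)=S_n\circ\cdots\circ S_1$; $\|\cdot\|_{\sup}$ is the sup-norm; $\log^+=\max\{\log,0\}$. $U^+=\{z\in\mathbb{C}^k:\overline{S(n)}([z:1])\to[0:\cdots:0:1:0]\}$ (extension to $\mathbb{P}^k$; limit point has only the $k$-th homogeneous coordinate nonzero). *)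

theory Defs
  imports "HOL-Analysis.Analysis"
begin

text \<open>Points of C^k are represented as functions nat => complex, with coordinates
  z 1, ..., z k; all other coordinates are 0.  The topology is the product topology
  on nat => complex, which restricted to Ck k is the Euclidean topology of C^k.\<close>

definition Ck :: "nat \<Rightarrow> (nat \<Rightarrow> complex) set" where
  "Ck k = {z. \<forall>j. (j = 0 \<or> j > k) \<longrightarrow> z j = 0}"

definition MI :: "nat \<Rightarrow> (nat \<Rightarrow> nat) set" where
  "MI k = {i. \<forall>j. (j < 2 \<or> j > k) \<longrightarrow> i j = 0}"

definition mdeg :: "nat \<Rightarrow> (nat \<Rightarrow> nat) \<Rightarrow> nat" where
  "mdeg k i = (\<Sum>j\<in>{2..k}. i j)"

definition monom :: "nat \<Rightarrow> (nat \<Rightarrow> nat) \<Rightarrow> (nat \<Rightarrow> complex) \<Rightarrow> complex" where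
  "monom k i z = (\<Prod>j\<in>{2..k}. z j ^ i j)"

definition mpoly :: "nat \<Rightarrow> ((nat \<Rightarrow> nat) \<Rightarrow> complex) \<Rightarrow> (nat \<Rightarrow> complex) \<Rightarrow> complex" where
  "mpoly k \<alpha> z = (\<Sum>i\<in>{i\<in>MI k. \<alpha> i \<noteq> 0}. \<alpha> i * monom k i z)"

definition lin_poly_degree :: "nat \<Rightarrow> complex \<Rightarrow> ((nat \<Rightarrow> nat) \<Rightarrow> complex) \<Rightarrow> nat" where
  "lin_poly_degree k a \<alpha> =
     Max ({0} \<union> (if a \<noteq> 0 then {1} else {}) \<union> {mdeg k i | i. i \<in> MI k \<and> \<alpha> i \<noteq> 0})"

definition pshift :: "nat \<Rightarrow> nat \<Rightarrow> complex \<Rightarrow> ((nat \<Rightarrow> nat) \<Rightarrow> complex)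
    \<Rightarrow> (nat \<Rightarrow> complex) \<Rightarrow> (nat \<Rightarrow> complex)" where
  "pshift k d a \<alpha> z = (\<lambda>j.
     if 1 \<le> j \<and> j \<le> k - 2 then z (j + 1)
     else if j = k - 1 then z k + z 2 ^ (d - 1)
     else if j = k then a * z 1 + mpoly k \<alpha> z + (\<Sum>l\<in>{2..k}. z l ^ d)
     else 0)"

fun Scomp :: "nat \<Rightarrow> nat \<Rightarrow> (nat \<Rightarrow> complex) \<Rightarrow> (nat \<Rightarrow> (nat \<Rightarrow> nat) \<Rightarrow> complex)
    \<Rightarrow> nat \<Rightarrow> (nat \<Rightarrow> complex) \<Rightarrow> (nat \<Rightarrow> complex)" where
  "Scomp k d a \<alpha> 0 = id"
| "Scomp k d a \<alpha> (Suc n) = pshift k d (a (Suc n)) (\<alpha> (Suc n)) \<circ> Scomp k d a \<alpha> n"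

definition supnorm :: "nat \<Rightarrow> (nat \<Rightarrow> complex) \<Rightarrow> real" where
  "supnorm k z = Max ((\<lambda>j. cmod (z j)) ` {1..k})"

definition logplus :: "real \<Rightarrow> real" where
  "logplus x = (if x \<le> 1 then 0 else ln x)"

text \<open>Convergence of [w(n):1] to [0:...:0:1:0] in P^k, read in the standard affine chart
  {x_k \<noteq> 0} around that point, whose coordinates are (x_j/x_k)_{j\<noteq>k, j\<le>k} and x_{k+1}/x_k.\<close>
definition tends_to_ek :: "nat \<Rightarrow> (nat \<Rightarrow> nat \<Rightarrow> complex) \<Rightarrow> bool" where
  "tends_to_ek k w \<longleftrightarrow>
     (\<forall>\<^sub>F n in sequentially. w n k \<noteq> 0) \<and>
     (\<forall>j\<in>{1..k} - {k}. ((\<lambda>n. w n j / w n k) \<longlongrightarrow> 0) sequentially) \<and>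
     ((\<lambda>n. 1 / w n k) \<longlongrightarrow> 0) sequentially"

definition Uplus :: "nat \<Rightarrow> nat \<Rightarrow> (nat \<Rightarrow> complex) \<Rightarrow> (nat \<Rightarrow> (nat \<Rightarrow> nat) \<Rightarrow> complex)
    \<Rightarrow> (nat \<Rightarrow> complex) set" where
  "Uplus k d a \<alpha> = {z \<in> Ck k. tends_to_ek k (\<lambda>n. Scomp k d a \<alpha> n z)}"

definition Ggreen :: "nat \<Rightarrow> nat \<Rightarrow> (nat \<Rightarrow> complex) \<Rightarrow> (nat \<Rightarrow> (nat \<Rightarrow> nat) \<Rightarrow> complex)
    \<Rightarrow> (nat \<Rightarrow> complex) \<Rightarrow> real" where
  "Ggreen k d a \<alpha> z =
     (if z \<in> Uplus k d a \<alpha>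
      then lim (\<lambda>n. logplus (supnorm k (Scomp k d a \<alpha> n z)) / real d ^ n)
      else 0)"

definition usc_on :: "'a::topological_space set \<Rightarrow> ('a \<Rightarrow> real) \<Rightarrow> bool" where
  "usc_on A u \<longleftrightarrow> (\<forall>x\<in>A. \<forall>c. u x < c \<longrightarrow> (\<forall>\<^sub>F y in at x within A. u y < c))"

text \<open>Subharmonic (real-valued) on C: upper semicontinuous with the sub-mean-value
  property on every circle.  For a real-valued usc function the circle average is either
  a finite integral or -infinity, so requiring integrability is part of the inequality.\<close>
definition subharmonic :: "(complex \<Rightarrow> real) \<Rightarrow> bool" where
  "subharmonic u \<longleftrightarrow> usc_on UNIV u \<and>
     (\<forall>w r. r > 0 \<longrightarrow>
        (\<lambda>t. u (w + complex_of_real r * cis t)) integrable_on {0..2*pi} \<and>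
        u w \<le> integral {0..2*pi} (\<lambda>t. u (w + complex_of_real r * cis t)) / (2*pi))"

definition psh_Ck :: "nat \<Rightarrow> ((nat \<Rightarrow> complex) \<Rightarrow> real) \<Rightarrow> bool" where
  "psh_Ck k u \<longleftrightarrow> usc_on (Ck k) u \<and>
     (\<forall>p\<in>Ck k. \<forall>v\<in>Ck k. subharmonic (\<lambda>\<zeta>. u (\<lambda>j. p j + \<zeta> * v j)))"

end

theory Submission
  imports Defs "HOL-Complex_Analysis.Complex_Analysis"
begin

text \<open>
  Put \<open>D(z) = max 1 \<parallel>z\<parallel>\<close> and \<open>u\<^sub>n(z) = d\<^sup>-\<^sup>n ln D(S(n)(z))\<close>. Since \<open>D(S\<^sub>n(z)) \<le> C D(z)\<^sup>d\<close>, the functions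
  \<open>u\<^sub>n + d\<^sup>-\<^sup>n ln C\<close> decrease on all of \<open>\<complex>\<^sup>k\<close>, so \<open>u\<^sub>n\<close> has a limit \<open>g \<ge> 0\<close> everywhere, which is upper
  semicontinuous and inherits the sub-mean-value property from the \<open>u\<^sub>n\<close>. All coordinates of \<open>S\<^sub>n(z)\<close>
  but the last are at most \<open>2 D(z)\<^sup>d\<^sup>-\<^sup>1\<close>; hence \<open>g(z) > 0\<close> forces the last one to dominate, that is
  \<open>z \<in> U\<^sup>+\<close>, and \<open>G = g\<close> on \<open>\<complex>\<^sup>k\<close>. The region where the last coordinate is large and dominates is open,
  mapped into itself by every \<open>S\<^sub>n\<close>, and there \<open>g \<ge> u\<^sub>n - d\<^sup>-\<^sup>n ln 2\<close>. This gives lower semicontinuity where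
  \<open>g > 0\<close>, and it shows that \<open>g\<close> is unbounded.
\<close>

section \<open>Circle means of exponents dominating a holomorphic function\<close>

text \<open>On each subinterval the left-endpoint value exceeds \<open>g\<close> by at most
  \<open>e\<close>, so its term is at most the integral over that piece plus \<open>s * e\<close>;
  the induction adds the pieces.\<close>

lemma riemann_sum_le_integral:
  fixes g :: "real \<Rightarrow> real"
  assumes cont: "continuous_on UNIV g" and s: "0 \<le> s"
    and close: "\<And>j t. j < N \<Longrightarrow> x + s * real j \<le> t \<Longrightarrow> t \<le> x + s * real (Suc j)
                  \<Longrightarrow> g (x + s * real j) \<le> g t + e"
  shows "(\<Sum>j<N. s * g (x + s * real j)) \<le> integral {x..x + s * real N} g + s * real N * e"
  using close
proof (induction N)
  case 0
  then show ?case by simp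
next
  case (Suc N)
  have int: "g integrable_on {p..q}" for p q
    by (rule integrable_continuous_real) (rule continuous_on_subset[OF cont], simp)
  let ?p = "x + s * real N" and ?q = "x + s * real (Suc N)"
  have pq: "?p \<le> ?q" and "x \<le> ?p"
    using s by (auto intro: mult_left_mono)
  have "integral {?p..?q} (\<lambda>t. g ?p - e) \<le> integral {?p..?q} g"
    by (rule integral_le[OF _ int]) (use Suc.prems[of N] in \<open>auto simp: algebra_simps\<close>)
  moreover have "integral {?p..?q} (\<lambda>t. g ?p - e) = s * (g ?p - e)"
    using pq by (simp add: algebra_simps)
  ultimately have "s * g ?p \<le> integral {?p..?q} g + s * e"
    by (simp add: algebra_simps)
  moreover have "integral {x..?q} g = integral {x..?p} g + integral {?p..?q} g"
    using Henstock_Kurzweil_Integration.integral_combine[OF \<open>x \<le> ?p\<close> pq int] by simp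
  moreover have "(\<Sum>j<N. s * g (x + s * real j)) \<le> integral {x..?p} g + s * real N * e"
    by (rule Suc.IH) (use Suc.prems in auto)
  ultimately show ?case
    by (simp add: algebra_simps)
qed

text \<open>Both integrals are split at \<open>T\<close>; the piece beyond \<open>T\<close> is
  translated back to \<open>{0..x}\<close> by one period.\<close>

lemma integral_periodic_shift:
  fixes g :: "real \<Rightarrow> real"
  assumes cont: "continuous_on UNIV g" and per: "\<And>t. g (t + T) = g t" and x: "0 \<le> x" "x \<le> T"
  shows "integral {x..x + T} g = integral {0..T} g"
proof -
  have int: "g integrable_on {p..q}" for p q
    by (rule integrable_continuous_real) (rule continuous_on_subset[OF cont], simp)
  have "integral {T..x + T} g = integral {0..x} (g \<circ> (\<lambda>t. t + T))"
    using integral_shift[of 0 T x g] continuous_on_subset[OF cont] by simp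
  also have "\<dots> = integral {0..x} g"
    by (simp add: o_def per)
  finally show ?thesis
    using Henstock_Kurzweil_Integration.integral_combine[of x T "x + T", OF _ _ int]
      Henstock_Kurzweil_Integration.integral_combine[of 0 x T, OF _ _ int] x by simp
qed

text \<open>The product of \<open>f\<close> over the rotations by the \<open>N\<close>-th roots of unity is holomorphic with value
  \<open>f w ^ N\<close> at the centre, and on the circle the mean of the exponents is a Riemann sum.\<close>

lemma norm_le_exp_circle_mean:
  fixes f :: "complex \<Rightarrow> complex" and u :: "complex \<Rightarrow> real"
  assumes f: "f holomorphic_on UNIV" and u: "continuous_on UNIV u" and r: "0 < r"
    and le: "\<And>z. norm (f z) \<le> exp (u z)"
  shows "norm (f w) \<le> exp (integral {0..2*pi} (\<lambda>t. u (w + of_real r * cis t)) / (2*pi))"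
proof -
  define g where "g t = u (w + of_real r * cis t)" for t
  define m where "m = integral {0..2*pi} g / (2*pi)"
  have cont: "continuous_on UNIV g"
    unfolding g_def by (intro continuous_intros continuous_on_compose2[OF u]) auto
  have per: "g (t + 2*pi) = g t" for t
    by (simp add: g_def cis.code)
  \<comment> \<open>A finite Riemann sum reaches the mean \<open>m\<close> only up to an error
    \<open>e\<close>, which is sent to 0 at the end.\<close>
  have "norm (f w) \<le> exp (m + e)" if "0 < e" for e
  proof -
    \<comment> \<open>The sample points start at an angle \<open>x\<close> in
      \<open>[0, 2*pi]\<close> and run through one full turn, hence the interval up to
      \<open>4*pi\<close>.\<close>
    have "uniformly_continuous_on {0..4*pi} g"
      by (intro compact_uniformly_continuous continuous_on_subset[OF cont]) auto
    then obtain \<delta> where \<delta>: "0 < \<delta>"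
        "\<And>s t. s \<in> {0..4*pi} \<Longrightarrow> t \<in> {0..4*pi} \<Longrightarrow> dist t s < \<delta> \<Longrightarrow> dist (g t) (g s) < e"
      unfolding uniformly_continuous_on_def using \<open>0 < e\<close> by blast
    obtain N where N: "2*pi/\<delta> < real N"
      using reals_Archimedean2 by blast
    have "N > 0"
      using N \<delta>(1) by (auto intro!: Nat.gr0I simp: divide_less_0_iff)
    define s where "s = 2*pi / real N"
    have s: "0 < s" "s < \<delta>" and sN: "s * real N = 2*pi"
      using N \<delta>(1) \<open>N > 0\<close> by (auto simp: s_def field_simps)
    define F where "F \<zeta> = (\<Prod>j<N. f (w + cis (s * real j) * \<zeta>))" for \<zeta>
    have F: "F holomorphic_on UNIV"
      unfolding F_def
      by (intro holomorphic_intros holomorphic_on_compose_gen[OF _ f, unfolded o_def]) auto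
    have "norm (F 0) \<le> exp (m + e) ^ N"
    proof (rule maximum_modulus_frontier[of F "cball 0 r"])
      fix \<zeta> :: complex assume "\<zeta> \<in> frontier (cball 0 r)"
      then have "norm \<zeta> = r"
        using r by simp
      then obtain x where \<zeta>: "\<zeta> = of_real r * cis x" and x: "0 \<le> x" "x \<le> 2*pi"
        using Arg2pi_eq[of \<zeta>] Arg2pi[of \<zeta>] r by (metis cis_conv_exp less_imp_le mult.commute)
      have "norm (F \<zeta>) \<le> (\<Prod>j<N. exp (g (x + s * real j)))"
        unfolding F_def prod_norm[symmetric]
        by (intro prod_mono) (auto intro: order.trans[OF le] simp: g_def \<zeta> cis_mult[symmetric] algebra_simps)
      also have "\<dots> = exp (\<Sum>j<N. g (x + s * real j))"
        by (simp add: exp_sum)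
      also have "(\<Sum>j<N. g (x + s * real j)) \<le> real N * (m + e)"
      proof -
        have "(\<Sum>j<N. s * g (x + s * real j)) \<le> integral {x..x + s * real N} g + s * real N * e"
        proof (rule riemann_sum_le_integral[OF cont])
          fix j t assume *: "j < N" "x + s * real j \<le> t" "t \<le> x + s * real (Suc j)"
          have "s * real (Suc j) \<le> s * real N"
            using * s by (intro mult_left_mono) auto
          then have "t \<le> 4*pi" "x + s * real j \<le> 4*pi"
            using * x sN by linarith+
          moreover have "0 \<le> x + s * real j"
            using x s by simp
          moreover have "dist t (x + s * real j) < \<delta>"
            using * s by (auto simp: dist_real_def algebra_simps)
          ultimately have "dist (g t) (g (x + s * real j)) < e"
            using \<delta>(2)[of "x + s * real j" t] * by auto
          then show "g (x + s * real j) \<le> g t + e"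
            by (auto simp: dist_real_def)
        qed (use s in simp)
        also have "\<dots> = 2*pi * (m + e)"
          using integral_periodic_shift[OF cont per x] by (simp add: sN m_def algebra_simps)
        finally have "s * (\<Sum>j<N. g (x + s * real j)) \<le> s * (real N * (m + e))"
          by (simp add: sum_distrib_left sN[symmetric] mult.assoc)
        then show ?thesis
          using s by simp
      qed
      finally show "norm (F \<zeta>) \<le> exp (m + e) ^ N"
        by (simp add: exp_of_nat_mult)
    qed (use F r in \<open>auto intro: holomorphic_on_subset holomorphic_on_imp_continuous_on\<close>)
    then have "norm (f w) ^ N \<le> exp (m + e) ^ N"
      by (simp add: F_def norm_power)
    then show ?thesis
      using \<open>N > 0\<close> by (simp add: power_mono_iff)
  qed
  moreover have "((\<lambda>e. exp (m + e)) \<longlongrightarrow> exp (m + 0)) (at_right 0)"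
    by (intro tendsto_intros)
  ultimately have "norm (f w) \<le> exp (m + 0)"
    by (intro tendsto_lowerbound[of _ _ "at_right 0"])
       (auto simp: eventually_at_right_less intro: eventually_mono[OF eventually_at_right_less])
  then show ?thesis
    by (simp add: m_def g_def[abs_def])
qed

section \<open>The truncated sup-norm\<close>

text \<open>This is \<open>D(z)\<close>: truncating at 1 keeps the logarithm nonnegative and makes
  it agree with \<open>logplus\<close> of the sup-norm.\<close>

definition supnorm1 :: "nat \<Rightarrow> (nat \<Rightarrow> complex) \<Rightarrow> real" where
  "supnorm1 k z = max 1 (supnorm k z)"

lemma supnorm1_ge_1 [simp]: "1 \<le> supnorm1 k z"
  by (simp add: supnorm1_def)

lemma supnorm1_pos [simp]: "0 < supnorm1 k z"
  using supnorm1_ge_1[of k z] by linarith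

lemma supnorm1_neq_0 [simp]: "supnorm1 k z \<noteq> 0"
  using supnorm1_pos[of k z] by linarith

lemma logplus_supnorm: "logplus (supnorm k z) = ln (supnorm1 k z)"
  by (auto simp: logplus_def supnorm1_def max_def)

lemma cmod_le_supnorm1: "j \<in> {1..k} \<Longrightarrow> cmod (z j) \<le> supnorm1 k z"
  unfolding supnorm1_def supnorm_def by (intro max.coboundedI2 Max_ge) auto

lemma supnorm1_le_iff:
  assumes "1 \<le> k"
  shows "supnorm1 k z \<le> b \<longleftrightarrow> 1 \<le> b \<and> (\<forall>j\<in>{1..k}. cmod (z j) \<le> b)"
  using assms by (subst supnorm1_def, subst supnorm_def) auto

lemma supnorm1_attained:
  assumes "1 \<le> k" "1 < supnorm1 k z"
  shows "\<exists>j\<in>{1..k}. cmod (z j) = supnorm1 k z"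
proof -
  have "Max ((\<lambda>j. cmod (z j)) ` {1..k}) \<in> (\<lambda>j. cmod (z j)) ` {1..k}"
    using assms by (intro Max_in) auto
  moreover have "Max ((\<lambda>j. cmod (z j)) ` {1..k}) = supnorm1 k z"
    using assms(2) by (auto simp: supnorm1_def supnorm_def max_def split: if_splits)
  ultimately show ?thesis
    by (metis imageE)
qed

lemma continuous_on_Max_image:
  fixes f :: "'i \<Rightarrow> 'a::topological_space \<Rightarrow> real"
  assumes "finite I" "I \<noteq> {}" "\<And>i. i \<in> I \<Longrightarrow> continuous_on A (f i)"
  shows "continuous_on A (\<lambda>x. Max ((\<lambda>i. f i x) ` I))"
  using assms
proof (induction I rule: finite_ne_induct)
  case (insert i I)
  then have "(\<lambda>x. Max ((\<lambda>i. f i x) ` insert i I)) = (\<lambda>x. max (f i x) (Max ((\<lambda>i. f i x) ` I)))"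
    by (simp add: fun_eq_iff)
  then show ?case
    using insert by (auto intro!: continuous_intros)
qed simp

lemma continuous_on_supnorm1:
  assumes "1 \<le> k" "\<And>j. continuous_on A (\<lambda>x. f x j)"
  shows "continuous_on A (\<lambda>x. supnorm1 k (f x))"
  unfolding supnorm1_def supnorm_def using assms
  by (intro continuous_intros continuous_on_Max_image) auto

section \<open>Continuity and holomorphy of the iterates\<close>

text \<open>The case distinction depends on \<open>j\<close> only; moving it outside the abstraction
  lets regularity in \<open>x\<close> be proved branch by branch.\<close>

lemma pshift_comp:
  "(\<lambda>x. pshift k d a \<alpha> (f x) j) =
     (if 1 \<le> j \<and> j \<le> k - 2 then \<lambda>x. f x (j + 1)
      else if j = k - 1 then \<lambda>x. f x k + f x 2 ^ (d - 1)
      else if j = k then \<lambda>x. a * f x 1 + mpoly k \<alpha> (f x) + (\<Sum>l\<in>{2..k}. f x l ^ d)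
      else (\<lambda>x. 0))"
  by (auto simp: fun_eq_iff pshift_def)

lemma continuous_on_pshift:
  assumes "\<And>j. continuous_on A (\<lambda>x. f x j)"
  shows "continuous_on A (\<lambda>x. pshift k d a \<alpha> (f x) j)"
  unfolding pshift_comp mpoly_def monom_def
  using assms by (auto intro!: continuous_intros)

lemma continuous_on_Scomp: "continuous_on A (\<lambda>z. Scomp k d a \<alpha> n z j)"
  by (induction n arbitrary: j)
     (auto intro: continuous_on_pshift continuous_on_subset[OF continuous_on_product_coordinates])

lemma holomorphic_on_pshift:
  assumes "\<And>j. (\<lambda>x. f x j) holomorphic_on A"
  shows "(\<lambda>x. pshift k d a \<alpha> (f x) j) holomorphic_on A"
  unfolding pshift_comp mpoly_def monom_def
  using assms by (auto intro!: holomorphic_intros)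

lemma holomorphic_on_Scomp:
  "(\<lambda>\<zeta>. Scomp k d a \<alpha> n (\<lambda>j. p j + \<zeta> * v j) j) holomorphic_on A"
  by (induction n arbitrary: j) (auto intro!: holomorphic_on_pshift holomorphic_intros)

section \<open>Upper growth bounds for a single shift\<close>

text \<open>The uniform bounds on the coefficients are condensed into \<open>lower_order\<close>:
  the unperturbed part of the last coordinate has order \<open>d - 2\<close>, with a constant
  independent of \<open>n\<close>.\<close>

locale perturbed_shifts =
  fixes k d :: nat and a :: "nat \<Rightarrow> complex" and \<alpha> :: "nat \<Rightarrow> (nat \<Rightarrow> nat) \<Rightarrow> complex"
    and B :: real
  assumes k: "3 \<le> k" and d: "3 \<le> d" and B: "0 \<le> B"
    and lower_order: "\<And>n z r. 1 \<le> n \<Longrightarrow> 1 \<le> r \<Longrightarrow> (\<And>j. j \<in> {1..k} \<Longrightarrow> cmod (z j) \<le> r)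
      \<Longrightarrow> cmod (a n * z 1 + mpoly k (\<alpha> n) z) \<le> B * r ^ (d - 2)"
begin

abbreviation shift :: "nat \<Rightarrow> (nat \<Rightarrow> complex) \<Rightarrow> (nat \<Rightarrow> complex)" where
  "shift n \<equiv> pshift k d (a n) (\<alpha> n)"

abbreviation orbit :: "nat \<Rightarrow> (nat \<Rightarrow> complex) \<Rightarrow> (nat \<Rightarrow> complex)" where
  "orbit \<equiv> Scomp k d a \<alpha>"

text \<open>The summand 2 covers the coordinates before the last; \<open>B\<close> and
  \<open>k\<close> cover the lower-order part and the power sum in the last one.\<close>

definition C :: real where "C = 2 + B + real k"

lemma shift_last: "shift n z k = (a n * z 1 + mpoly k (\<alpha> n) z) + (\<Sum>l\<in>{2..k}. z l ^ d)"
  using k by (auto simp: pshift_def)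

text \<open>Only the last coordinate contains \<open>d\<close>-th powers. This gap of one order is
  what later forces the last coordinate to dominate.\<close>

lemma shift_lt_last_le:
  assumes r: "1 \<le> r" "\<And>j. j \<in> {1..k} \<Longrightarrow> cmod (z j) \<le> r" and j: "j < k"
  shows "cmod (shift n z j) \<le> 2 * r ^ (d - 1)"
proof -
  have r1: "r \<le> r ^ (d - 1)"
    using r d by (intro self_le_power) auto
  consider "1 \<le> j \<and> j \<le> k - 2" | "j = k - 1" | "j = 0"
    using j by linarith
  then show ?thesis
  proof cases
    case 1
    then have "cmod (z (j + 1)) \<le> r"
      using j by (intro r) auto
    then show ?thesis
      using 1 r1 r by (simp add: pshift_def)
  next
    case 2
    have "cmod (z k + z 2 ^ (d - 1)) \<le> cmod (z k) + cmod (z 2) ^ (d - 1)"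
      by (metis norm_power norm_triangle_ineq)
    also have "\<dots> \<le> r + r ^ (d - 1)"
      using k by (intro add_mono power_mono r) auto
    finally show ?thesis
      using 2 r1 k by (auto simp: pshift_def)
  next
    case 3
    then show ?thesis
      using r k by (simp add: pshift_def)
  qed
qed

lemma supnorm1_shift_le:
  assumes n: "1 \<le> n"
  shows "supnorm1 k (shift n z) \<le> C * supnorm1 k z ^ d"
proof -
  define r where "r = supnorm1 k z"
  have r: "1 \<le> r" "\<And>j. j \<in> {1..k} \<Longrightarrow> cmod (z j) \<le> r"
    by (auto simp: r_def intro: cmod_le_supnorm1)
  have rd: "1 \<le> r ^ d" "r ^ (d - 1) \<le> r ^ d" "r ^ (d - 2) \<le> r ^ d"
    using r by (auto intro: power_increasing)
  have C: "2 * r ^ d \<le> C * r ^ d"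
    unfolding C_def using B rd by (intro mult_right_mono) auto
  have "cmod (shift n z j) \<le> C * r ^ d" if j: "j \<in> {1..k}" for j
  proof (cases "j = k")
    case True
    have "cmod (shift n z k) \<le> B * r ^ (d - 2) + (\<Sum>l\<in>{2..k}. r ^ d)"
      unfolding shift_last
      by (intro order.trans[OF norm_triangle_ineq] add_mono lower_order n r
            order.trans[OF norm_sum] sum_mono)
         (auto simp: norm_power intro!: power_mono r)
    also have "(\<Sum>l\<in>{2..k}. r ^ d) \<le> real k * r ^ d"
      using k rd by (auto intro!: mult_right_mono)
    also have "B * r ^ (d - 2) \<le> B * r ^ d"
      using rd B by (intro mult_left_mono) auto
    finally show ?thesis
      using True rd by (simp add: C_def algebra_simps)
  next
    case False
    then have "cmod (shift n z j) \<le> 2 * r ^ (d - 1)"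
      using j by (intro shift_lt_last_le r) auto
    then show ?thesis
      using rd C by linarith
  qed
  moreover have "1 \<le> C * r ^ d"
    using C rd by linarith
  ultimately show ?thesis
    using k by (auto simp: supnorm1_le_iff r_def)
qed

section \<open>The normalized potentials and their limit\<close>

definition pot :: "nat \<Rightarrow> (nat \<Rightarrow> complex) \<Rightarrow> real" where
  "pot n z = ln (supnorm1 k (orbit n z)) / real d ^ n"

text \<open>This is \<open>g\<close>, defined at every point and not just on \<open>Uplus\<close>;
  \<open>pot_tendsto\<close> shows that the limit exists.\<close>

definition green :: "(nat \<Rightarrow> complex) \<Rightarrow> real" where
  "green z = lim (\<lambda>n. pot n z)"

lemma pot_nonneg [simp]: "0 \<le> pot n z"
  unfolding pot_def by (intro divide_nonneg_nonneg) auto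

lemma continuous_on_pot: "continuous_on A (pot n)"
proof -
  have "continuous_on A (\<lambda>z. supnorm1 k (orbit n z))"
    using k by (intro continuous_on_supnorm1 continuous_on_Scomp) auto
  then show ?thesis
    unfolding pot_def using d by (auto intro!: continuous_intros simp: less_imp_neq[symmetric])
qed

lemma C_ge: "2 \<le> C"
  using B by (simp add: C_def)

text \<open>Taking logarithms in \<open>supnorm1_shift_le\<close> costs \<open>ln C\<close>. Adding
  \<open>ln C\<close> to both sides leaves \<open>2 * ln C\<close> on the right, which
  \<open>real d * ln C\<close> absorbs.\<close>

lemma pot_Suc_le: "pot (Suc n) z + ln C / real d ^ Suc n \<le> pot n z + ln C / real d ^ n"
proof -
  have "ln (supnorm1 k (orbit (Suc n) z)) \<le> ln (C * supnorm1 k (orbit n z) ^ d)"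
    using supnorm1_shift_le[of "Suc n" "orbit n z"] by (intro ln_mono) auto
  also have "\<dots> = ln C + real d * ln (supnorm1 k (orbit n z))"
    using C_ge by (subst ln_mult) (auto simp: ln_realpow)
  finally have "ln (supnorm1 k (orbit (Suc n) z)) \<le> ln C + real d * ln (supnorm1 k (orbit n z))" .
  moreover have "2 * ln C \<le> real d * ln C"
    using C_ge d by (intro mult_right_mono) auto
  ultimately have "ln (supnorm1 k (orbit (Suc n) z)) + ln C
      \<le> real d * (ln (supnorm1 k (orbit n z)) + ln C)"
    unfolding distrib_left by linarith
  then have "(ln (supnorm1 k (orbit (Suc n) z)) + ln C) / real d ^ Suc n
      \<le> real d * (ln (supnorm1 k (orbit n z)) + ln C) / real d ^ Suc n"
    by (intro divide_right_mono) auto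
  then show ?thesis
    using d by (simp add: pot_def add_divide_distrib)
qed

lemma decseq_pot: "decseq (\<lambda>n. pot n z + ln C / real d ^ n)"
  by (intro decseq_SucI pot_Suc_le)

lemma inverse_power_d_tendsto: "(\<lambda>n. c / real d ^ n) \<longlonglongrightarrow> 0"
  using LIMSEQ_divide_realpow_zero[of "real d" c] d by simp

lemma pot_tendsto: "(\<lambda>n. pot n z) \<longlonglongrightarrow> green z"
proof -
  have "0 \<le> pot n z + ln C / real d ^ n" for n
    using C_ge by (intro add_nonneg_nonneg divide_nonneg_nonneg) auto
  then obtain L where "(\<lambda>n. pot n z + ln C / real d ^ n) \<longlonglongrightarrow> L"
    using decseq_convergent[OF decseq_pot] by metis
  from tendsto_diff[OF this inverse_power_d_tendsto[of "ln C"]]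
  have "(\<lambda>n. pot n z) \<longlonglongrightarrow> L"
    by simp
  then show ?thesis
    by (simp add: green_def limI)
qed

lemma green_nonneg: "0 \<le> green z"
  by (rule LIMSEQ_le_const[OF pot_tendsto]) auto

text \<open>A decreasing sequence lies above its limit, and the correction vanishes in the limit.
  Being valid everywhere, this yields upper semicontinuity.\<close>

lemma green_le_pot: "green z \<le> pot n z + ln C / real d ^ n"
  using decseq_ge[OF decseq_pot, of z "green z" n]
    tendsto_add[OF pot_tendsto inverse_power_d_tendsto[of "ln C"]] by simp

section \<open>The invariant region where the last coordinate dominates\<close>

text \<open>The term \<open>4 * B\<close> bounds the lower-order part by a quarter of the leading
  power, the factor \<open>4 * real k\<close> does the same for the other \<open>d\<close>-th
  powers, and \<open>16 * real k\<close> restores domination after one step. Strict inequalities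
  make the preimages under \<open>orbit n\<close> open.\<close>

definition trap :: "(nat \<Rightarrow> complex) set" where
  "trap = {z. 16 * real k + 4 * B < cmod (z k) \<and> (\<forall>j\<in>{1..<k}. 4 * real k * cmod (z j) < cmod (z k))}"

lemma trap_le:
  assumes "z \<in> trap" "j \<in> {1..k}"
  shows "cmod (z j) \<le> cmod (z k)"
proof (cases "j = k")
  case False
  then have "4 * real k * cmod (z j) < cmod (z k)"
    using assms by (auto simp: trap_def)
  moreover have "1 * cmod (z j) \<le> 4 * real k * cmod (z j)"
    using k by (intro mult_right_mono) auto
  ultimately show ?thesis by simp
qed simp

lemma trap_large: "z \<in> trap \<Longrightarrow> 48 \<le> cmod (z k)"
  using k B unfolding trap_def by auto

lemma supnorm1_trap: "z \<in> trap \<Longrightarrow> supnorm1 k z = cmod (z k)"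
  using k trap_large[of z] by (intro antisym cmod_le_supnorm1) (auto simp: supnorm1_le_iff trap_le)

text \<open>The lower-order part and the remaining powers each consume at most a quarter of
  \<open>x ^ d\<close>, so half of it survives, while the other coordinates have order
  \<open>d - 1\<close>.\<close>

lemma shift_trap:
  assumes z: "z \<in> trap" and n: "1 \<le> n"
  shows "cmod (shift n z k) \<ge> cmod (z k) ^ d / 2" and "shift n z \<in> trap"
proof -
  define x where "x = cmod (z k)"
  have x: "1 \<le> x" "\<And>j. j \<in> {1..k} \<Longrightarrow> cmod (z j) \<le> x"
    using trap_large[OF z] trap_le[OF z] by (auto simp: x_def)
  have xR: "16 * real k + 4 * B < x"
    using z by (auto simp: trap_def x_def)
  have xd: "x ^ d = x * x ^ (d - 1)"
    using d by (simp add: power_eq_if)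
  have "4 * B * x ^ (d - 2) \<le> x * x ^ (d - 1)"
    using xR x B by (intro mult_mono power_increasing) auto
  then have low: "cmod (a n * z 1 + mpoly k (\<alpha> n) z) \<le> x ^ d / 4"
    using lower_order[of n x z] n x xd by simp
  have mid: "cmod (\<Sum>l\<in>{2..<k}. z l ^ d) \<le> x ^ d / 4"
  proof -
    have "cmod (z l ^ d) \<le> x ^ d / (4 * real k)" if "l \<in> {2..<k}" for l
    proof -
      have "cmod (z l) ^ d \<le> (x / (4 * real k)) ^ d"
        using z that k by (intro power_mono) (auto simp: trap_def x_def field_simps less_imp_le)
      also have "\<dots> = x ^ d / (4 * real k) ^ d"
        by (simp add: power_divide)
      \<comment> \<open>One factor \<open>4 * real k\<close> suffices: fewer than \<open>k\<close>
        such terms then sum to at most \<open>x ^ d / 4\<close>.\<close>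
      also have "\<dots> \<le> x ^ d / (4 * real k)"
        using x k d by (intro divide_left_mono self_le_power) auto
      finally show ?thesis by (simp add: norm_power)
    qed
    then have "cmod (\<Sum>l\<in>{2..<k}. z l ^ d) \<le> (\<Sum>l\<in>{2..<k}. x ^ d / (4 * real k))"
      by (intro order.trans[OF norm_sum] sum_mono)
    also have "\<dots> \<le> real k * (x ^ d / (4 * real k))"
      unfolding sum_constant using x by (intro mult_right_mono) auto
    finally show ?thesis
      using k by simp
  qed
  have "{2..k} = insert k {2..<k}"
    using k by auto
  then have "shift n z k = z k ^ d + ((a n * z 1 + mpoly k (\<alpha> n) z) + (\<Sum>l\<in>{2..<k}. z l ^ d))"
    by (simp add: shift_last)
  then have "cmod (z k ^ d) \<le> cmod (shift n z k)
      + cmod ((a n * z 1 + mpoly k (\<alpha> n) z) + (\<Sum>l\<in>{2..<k}. z l ^ d))"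
    by (metis add_diff_cancel_right' norm_triangle_ineq4)
  also have "cmod ((a n * z 1 + mpoly k (\<alpha> n) z) + (\<Sum>l\<in>{2..<k}. z l ^ d)) \<le> x ^ d / 2"
    using norm_triangle_le[OF add_mono[OF low mid]] by simp
  finally have main: "x ^ d / 2 \<le> cmod (shift n z k)"
    by (simp add: norm_power x_def)
  then show "cmod (shift n z k) \<ge> cmod (z k) ^ d / 2"
    by (simp add: x_def)
  have "x \<le> x ^ (d - 1)"
    using x d by (intro self_le_power) auto
  \<comment> \<open>Thus \<open>x \<le> x ^ d / 2\<close>, so the modulus of the last coordinate
    does not decrease and stays above the threshold of \<open>trap\<close>.\<close>
  then have "2 * x \<le> x * x ^ (d - 1)"
    using x trap_large[OF z] by (intro mult_mono) (auto simp: x_def)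
  then have "x \<le> cmod (shift n z k)"
    using main xd by simp
  moreover have "4 * real k * cmod (shift n z j) < cmod (shift n z k)" if "j \<in> {1..<k}" for j
  proof -
    have "4 * real k * cmod (shift n z j) \<le> 4 * real k * (2 * x ^ (d - 1))"
      using that by (intro mult_left_mono shift_lt_last_le x) auto
    also have "\<dots> < x / 2 * x ^ (d - 1)"
      using xR B x by simp
    finally show ?thesis
      using main xd by simp
  qed
  ultimately show "shift n z \<in> trap"
    using xR by (auto simp: trap_def)
qed

lemma orbit_trap:
  assumes "orbit n z \<in> trap" "n \<le> m"
  shows "orbit m z \<in> trap"
  using assms(2) by (induction m rule: dec_induct) (use assms(1) shift_trap in auto)

text \<open>The factor 1/2 in \<open>shift_trap\<close> costs \<open>ln 2\<close>, absorbed as in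
  \<open>pot_Suc_le\<close> but with the opposite sign.\<close>

lemma pot_Suc_ge:
  assumes "orbit n z \<in> trap"
  shows "pot n z - ln 2 / real d ^ n \<le> pot (Suc n) z - ln 2 / real d ^ Suc n"
proof -
  let ?x = "cmod (orbit n z k)"
  have x: "48 \<le> ?x"
    by (rule trap_large[OF assms])
  have "?x ^ d / 2 \<le> supnorm1 k (orbit (Suc n) z)"
    using shift_trap[OF assms, of "Suc n"] by (simp add: supnorm1_trap)
  then have "ln (?x ^ d / 2) \<le> ln (supnorm1 k (orbit (Suc n) z))"
    using x by (intro ln_mono) (auto intro!: zero_less_power)
  moreover have "ln (?x ^ d / 2) = real d * ln ?x - ln 2"
    using x by (subst ln_div) (auto simp: ln_realpow)
  moreover have "2 * ln 2 \<le> real d * ln 2"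
    using d by (intro mult_right_mono) auto
  ultimately have "real d * (ln (supnorm1 k (orbit n z)) - ln 2)
      \<le> ln (supnorm1 k (orbit (Suc n) z)) - ln 2"
    unfolding right_diff_distrib supnorm1_trap[OF assms] by linarith
  then have "real d * (ln (supnorm1 k (orbit n z)) - ln 2) / real d ^ Suc n
      \<le> (ln (supnorm1 k (orbit (Suc n) z)) - ln 2) / real d ^ Suc n"
    by (intro divide_right_mono) auto
  then show ?thesis
    using d by (simp add: pot_def diff_divide_distrib)
qed

text \<open>By invariance of \<open>trap\<close> the corrected sequence increases from index
  \<open>n\<close> on, so its term at \<open>n\<close> lies below the limit.\<close>

lemma pot_le_green:
  assumes "orbit n z \<in> trap"
  shows "pot n z - ln 2 / real d ^ n \<le> green z"
proof -
  have "incseq (\<lambda>m. pot (m + n) z - ln 2 / real d ^ (m + n))"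
    using pot_Suc_ge[OF orbit_trap[OF assms]] by (intro incseq_SucI) simp
  moreover have "(\<lambda>m. pot (m + n) z - ln 2 / real d ^ (m + n)) \<longlonglongrightarrow> green z - 0"
    by (intro LIMSEQ_ignore_initial_segment tendsto_diff pot_tendsto inverse_power_d_tendsto)
  ultimately show ?thesis
    using incseq_le[of _ "green z" 0] by fastforce
qed

section \<open>Positivity of the limit and the set \<open>Uplus\<close>\<close>

text \<open>The logarithm of \<open>D (Suc n) / D n ^ (d - 1)\<close> is \<open>d ^ n\<close> times
  a quantity tending to \<open>green z\<close>, so the quotient tends to infinity. The coordinates
  before the last are at most \<open>2 * D n ^ (d - 1)\<close> and become negligible.\<close>

lemma tends_to_ek_if_green_pos:
  assumes "0 < green z"
  shows "tends_to_ek k (\<lambda>n. orbit n z)"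
proof -
  define D where "D n = supnorm1 k (orbit n z)" for n
  have D: "1 \<le> D n" "0 < D n" "D n \<noteq> 0" for n
    by (auto simp: D_def)
  have lnD: "ln (D n) = real d ^ n * pot n z" for n
    using d by (simp add: D_def pot_def)
  have pow: "filterlim (\<lambda>n. real d ^ n) at_top sequentially"
    using d by (intro filterlim_at_infinity_imp_filterlim_at_top filterlim_realpow_sequentially_gt1) auto
  have "filterlim (\<lambda>n. real d ^ n * pot n z) at_top sequentially"
    using filterlim_tendsto_pos_mult_at_top[OF pot_tendsto assms pow] by (simp add: mult.commute)
  then have "filterlim (\<lambda>n. exp (real d ^ n * pot n z)) at_top sequentially"
    by (rule filterlim_compose[OF exp_at_top])
  then have D_top: "filterlim D at_top sequentially"
    using D by (simp flip: lnD)
  have "(\<lambda>n. real d * pot (Suc n) z - real (d - 1) * pot n z)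
      \<longlonglongrightarrow> real d * green z - real (d - 1) * green z"
    by (intro tendsto_intros LIMSEQ_Suc pot_tendsto)
  moreover have "real d * green z - real (d - 1) * green z = green z"
    using d by (simp add: of_nat_diff algebra_simps)
  ultimately have "(\<lambda>n. real d * pot (Suc n) z - real (d - 1) * pot n z) \<longlonglongrightarrow> green z"
    by simp
  then have "filterlim (\<lambda>n. (real d * pot (Suc n) z - real (d - 1) * pot n z) * real d ^ n)
      at_top sequentially"
    using filterlim_tendsto_pos_mult_at_top[OF _ assms pow] by simp
  moreover have "(real d * pot (Suc n) z - real (d - 1) * pot n z) * real d ^ n
      = ln (D (Suc n) / D n ^ (d - 1))" for n
    using D by (simp add: ln_div ln_realpow lnD algebra_simps del: of_nat_diff)
  ultimately have "filterlim (\<lambda>n. exp (ln (D (Suc n) / D n ^ (d - 1)))) at_top sequentially"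
    by (auto intro: filterlim_compose[OF exp_at_top])
  then have quot: "filterlim (\<lambda>n. D (Suc n) / D n ^ (d - 1)) at_top sequentially"
    using D by simp
  have other: "cmod (orbit (Suc n) z j) \<le> 2 * D n ^ (d - 1)" if "j < k" for n j
    using that unfolding D_def Scomp.simps o_def by (intro shift_lt_last_le cmod_le_supnorm1) auto
  \<comment> \<open>The threshold 2 is the constant in \<open>shift_lt_last_le\<close>: beyond it no
    other coordinate can attain the norm.\<close>
  have "\<forall>\<^sub>F n in sequentially. 2 < D (Suc n) / D n ^ (d - 1)"
    using quot by (simp add: filterlim_at_top_dense)
  then have dom: "\<forall>\<^sub>F n in sequentially. cmod (orbit (Suc n) z k) = D (Suc n)"
  proof eventually_elim
    case (elim n)
    then have *: "2 * D n ^ (d - 1) < D (Suc n)"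
      using D by (simp add: pos_less_divide_eq)
    moreover have "1 \<le> D n ^ (d - 1)"
      using D by (simp add: one_le_power)
    \<comment> \<open>This excludes that the truncation at 1 is active, so some coordinate attains
      the norm.\<close>
    ultimately have "1 < D (Suc n)"
      by linarith
    then obtain j where "j \<in> {1..k}" "cmod (orbit (Suc n) z j) = D (Suc n)"
      using supnorm1_attained[of k "orbit (Suc n) z"] k unfolding D_def by auto
    then show ?case
      using other[of j n] * by (cases "j = k") auto
  qed
  have "\<forall>\<^sub>F n in sequentially. orbit (Suc n) z k \<noteq> 0"
    using dom by eventually_elim (use D in \<open>metis less_irrefl norm_zero\<close>)
  then have nz: "\<forall>\<^sub>F n in sequentially. orbit n z k \<noteq> 0"
    using eventually_sequentially_Suc[of "\<lambda>n. orbit n z k \<noteq> 0"] by blast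
  have "((\<lambda>n. 1 / orbit (Suc n) z k) \<longlongrightarrow> 0) sequentially"
  proof (rule Lim_null_comparison)
    show "\<forall>\<^sub>F n in sequentially. norm (1 / orbit (Suc n) z k) \<le> inverse (D (Suc n))"
      using dom by eventually_elim (simp add: norm_divide inverse_eq_divide)
    show "(\<lambda>n. inverse (D (Suc n))) \<longlonglongrightarrow> 0"
      by (intro LIMSEQ_Suc tendsto_inverse_0_at_top D_top)
  qed
  then have inv: "((\<lambda>n. 1 / orbit n z k) \<longlongrightarrow> 0) sequentially"
    using filterlim_sequentially_Suc[of "\<lambda>n. 1 / orbit n z k"] by blast
  have ratio: "((\<lambda>n. orbit n z j / orbit n z k) \<longlongrightarrow> 0) sequentially" if "j < k" for j
  proof -
    have "((\<lambda>n. orbit (Suc n) z j / orbit (Suc n) z k) \<longlongrightarrow> 0) sequentially"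
    proof (rule Lim_null_comparison)
      show "\<forall>\<^sub>F n in sequentially. norm (orbit (Suc n) z j / orbit (Suc n) z k)
          \<le> 2 * inverse (D (Suc n) / D n ^ (d - 1))"
        using dom
      proof eventually_elim
        case (elim n)
        have "norm (orbit (Suc n) z j / orbit (Suc n) z k) \<le> 2 * D n ^ (d - 1) / D (Suc n)"
          unfolding norm_divide elim using D by (intro divide_right_mono other that) (simp add: less_imp_le)
        then show ?case
          by (simp add: field_simps)
      qed
      show "(\<lambda>n. 2 * inverse (D (Suc n) / D n ^ (d - 1))) \<longlonglongrightarrow> 0"
        by (rule tendsto_mult_right_zero, rule tendsto_inverse_0_at_top[OF quot])
    qed
    then show ?thesis
      using filterlim_sequentially_Suc[of "\<lambda>n. orbit n z j / orbit n z k"] by blast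
  qed
  show ?thesis
    unfolding tends_to_ek_def using nz inv ratio by auto
qed

text \<open>In the affine chart around the limit point, the conditions of \<open>trap\<close> are
  finitely many smallness conditions on the chart coordinates.\<close>

lemma eventually_trap:
  assumes "tends_to_ek k (\<lambda>n. orbit n z)"
  shows "\<forall>\<^sub>F n in sequentially. orbit n z \<in> trap"
proof -
  have nz: "\<forall>\<^sub>F n in sequentially. orbit n z k \<noteq> 0"
    and inv: "((\<lambda>n. 1 / orbit n z k) \<longlongrightarrow> 0) sequentially"
    and ratio: "\<And>j. j \<in> {1..<k} \<Longrightarrow> ((\<lambda>n. orbit n z j / orbit n z k) \<longlongrightarrow> 0) sequentially"
    using assms by (auto simp: tends_to_ek_def)
  have R: "0 < 16 * real k + 4 * B"
    using k B by simp
  have "\<forall>\<^sub>F n in sequentially. cmod (1 / orbit n z k) < 1 / (16 * real k + 4 * B)"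
    using tendstoD[OF inv, of "1 / (16 * real k + 4 * B)"] R by simp
  moreover have "\<forall>\<^sub>F n in sequentially. \<forall>j\<in>{1..<k}. cmod (orbit n z j / orbit n z k) < 1 / (4 * real k)"
    using tendstoD[OF ratio, of _ "1 / (4 * real k)"] k by (intro eventually_ball_finite) auto
  ultimately show ?thesis
    using nz
  proof eventually_elim
    case (elim n)
    then show ?case
      using R k by (auto simp: trap_def norm_divide field_simps)
  qed
qed

text \<open>Off \<open>Uplus\<close> the limit must vanish by
  \<open>tends_to_ek_if_green_pos\<close>, so extending by 0 agrees with the globally defined
  limit.\<close>

lemma Ggreen_eq_green:
  assumes "z \<in> Ck k"
  shows "Ggreen k d a \<alpha> z = green z"
proof (cases "z \<in> Uplus k d a \<alpha>")
  case True
  then show ?thesis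
    by (simp add: Ggreen_def green_def pot_def logplus_supnorm)
next
  case False
  then have "\<not> 0 < green z"
    using assms tends_to_ek_if_green_pos by (auto simp: Uplus_def)
  then show ?thesis
    using False green_nonneg[of z] by (simp add: Ggreen_def)
qed

section \<open>Continuity and unboundedness of the limit\<close>

lemma open_orbit_trap: "open {z. orbit n z \<in> trap}"
proof -
  have "{z. orbit n z \<in> trap} = {z. 16 * real k + 4 * B < cmod (orbit n z k)}
      \<inter> (\<Inter>j\<in>{1..<k}. {z. 4 * real k * cmod (orbit n z j) < cmod (orbit n z k)})"
    by (auto simp: trap_def)
  then show ?thesis
    by (auto intro!: open_INT open_Int open_Collect_less continuous_intros continuous_on_Scomp)
qed

lemma continuous_on_green: "continuous_on UNIV green"
proof -
  have "(green \<longlongrightarrow> green z) (at z)" for z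
  proof (rule order_tendstoI)
    fix c assume c: "green z < c"
    have "(\<lambda>n. pot n z + ln C / real d ^ n) \<longlonglongrightarrow> green z + 0"
      by (intro tendsto_add pot_tendsto inverse_power_d_tendsto)
    then have "\<forall>\<^sub>F n in sequentially. pot n z + ln C / real d ^ n < c"
      using c by (intro order_tendstoD) auto
    then obtain n where n: "pot n z + ln C / real d ^ n < c"
      by (auto simp: eventually_sequentially)
    have "((\<lambda>y. pot n y + ln C / real d ^ n) \<longlongrightarrow> pot n z + ln C / real d ^ n) (at z)"
      using continuous_on_pot[of UNIV n] by (intro tendsto_intros) (auto simp: continuous_on_def)
    from order_tendstoD(2)[OF this n]
    show "\<forall>\<^sub>F y in at z. green y < c"
      by eventually_elim (use green_le_pot le_less_trans in blast)
  next
    fix c assume c: "c < green z"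
    show "\<forall>\<^sub>F y in at z. c < green y"
    proof (cases "0 < green z")
      \<comment> \<open>Here \<open>green z\<close> is 0, the minimum of \<open>green\<close>, so
        the lower estimate is trivial.\<close>
      case False
      then show ?thesis
        using c green_nonneg by (intro always_eventually) (meson less_le_trans not_less order.trans le_less_trans)
    next
      case True
      have "(\<lambda>n. pot n z - ln 2 / real d ^ n) \<longlonglongrightarrow> green z - 0"
        by (intro tendsto_diff pot_tendsto inverse_power_d_tendsto)
      then have "\<forall>\<^sub>F n in sequentially. c < pot n z - ln 2 / real d ^ n"
        using c by (intro order_tendstoD) auto
      with eventually_trap[OF tends_to_ek_if_green_pos[OF True]]
      \<comment> \<open>One \<open>n\<close> serves both conditions; each of them persists near
        \<open>z\<close>, where \<open>pot_le_green\<close> then applies with this same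
        \<open>n\<close>.\<close>
      have "\<forall>\<^sub>F n in sequentially. orbit n z \<in> trap \<and> c < pot n z - ln 2 / real d ^ n"
        by (rule eventually_conj)
      then obtain n where n: "orbit n z \<in> trap" "c < pot n z - ln 2 / real d ^ n"
        by (auto simp: eventually_sequentially)
      have "((\<lambda>y. pot n y - ln 2 / real d ^ n) \<longlongrightarrow> pot n z - ln 2 / real d ^ n) (at z)"
        using continuous_on_pot[of UNIV n] by (intro tendsto_intros) (auto simp: continuous_on_def)
      from order_tendstoD(1)[OF this n(2)]
      have "\<forall>\<^sub>F y in at z. c < pot n y - ln 2 / real d ^ n" .
      moreover have "\<forall>\<^sub>F y in at z. y \<in> {z. orbit n z \<in> trap}"
        using n(1) by (intro eventually_at_in_open' open_orbit_trap) auto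
      ultimately show ?thesis
        by eventually_elim (use pot_le_green less_le_trans in blast)
    qed
  qed
  then show ?thesis
    by (auto simp: continuous_on_def)
qed

lemma green_unbounded: "\<exists>z\<in>Ck k. c < green z"
proof -
  \<comment> \<open>The first three summands place the point of the last axis in \<open>trap\<close>
    at time 0; \<open>2 * exp c\<close> outweighs the loss of \<open>ln 2\<close>.\<close>
  define x where "x = 16 * real k + 4 * B + 1 + 2 * exp c"
  define z :: "nat \<Rightarrow> complex" where "z = (\<lambda>j. if j = k then of_real x else 0)"
  have x: "0 < x"
    using B by (simp add: x_def add_nonneg_pos)
  have trap: "z \<in> trap"
    using B k x by (auto simp: trap_def z_def) (simp add: x_def add_pos_pos)
  have "2 * exp c < x"
    using B k by (simp add: x_def add_nonneg_pos)
  then have "ln (2 * exp c) < ln x"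
    by (subst ln_less_cancel_iff) (use x in auto)
  then have "c + ln 2 < ln x"
    by (simp add: ln_mult)
  also have "ln x = pot 0 z"
    using x by (simp add: pot_def supnorm1_trap[OF trap]) (simp add: z_def)
  finally have "c < green z"
    using pot_le_green[of 0 z] trap by simp
  moreover have "z \<in> Ck k"
    using k by (auto simp: Ck_def z_def)
  ultimately show ?thesis by blast
qed

section \<open>Subharmonicity on complex lines and the conclusion for \<open>Ggreen\<close>\<close>

text \<open>Each coordinate of the orbit is holomorphic along the line, so
  \<open>norm_le_exp_circle_mean\<close> gives the mean inequality for \<open>pot n\<close>;
  dominated convergence carries it to the limit.\<close>

lemma subharmonic_green:
  "subharmonic (\<lambda>\<zeta>. green (\<lambda>j. p j + \<zeta> * v j))"
proof -
  define l where "l \<zeta> = (\<lambda>j. p j + \<zeta> * v j)" for \<zeta>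
  have l: "continuous_on UNIV l"
    unfolding l_def by (intro continuous_intros)
  have cont: "continuous_on UNIV (\<lambda>\<zeta>. green (l \<zeta>))"
    by (rule continuous_on_compose2[OF continuous_on_green l]) auto
  have contn: "continuous_on UNIV (\<lambda>\<zeta>. pot n (l \<zeta>))" for n
    by (rule continuous_on_compose2[OF continuous_on_pot l]) auto
  have circ: "continuous_on {0..2*pi} (\<lambda>t. f (w + of_real r * cis t))"
    if "continuous_on UNIV f" for f :: "complex \<Rightarrow> real" and w r
    by (intro continuous_intros continuous_on_compose2[OF that]) auto
  have mean: "green (l w) \<le> integral {0..2*pi} (\<lambda>t. green (l (w + of_real r * cis t))) / (2*pi)"
    if r: "0 < r" for w r
  proof -
    define M where "M n = integral {0..2*pi} (\<lambda>t. pot n (l (w + of_real r * cis t))) / (2*pi)" for n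
    have "pot n (l w) \<le> M n" for n
    proof -
      let ?u = "\<lambda>\<zeta>. real d ^ n * pot n (l \<zeta>)"
      have exp_u: "exp (?u \<zeta>) = supnorm1 k (orbit n (l \<zeta>))" for \<zeta>
        using d by (simp add: pot_def)
      have mean_u: "integral {0..2*pi} (\<lambda>t. ?u (w + of_real r * cis t)) / (2*pi) = real d ^ n * M n"
        by (simp add: M_def)
      have "cmod (orbit n (l w) j) \<le> exp (real d ^ n * M n)" if "j \<in> {1..k}" for j
        unfolding mean_u[symmetric]
      proof (rule norm_le_exp_circle_mean[OF _ _ r])
        show "(\<lambda>\<zeta>. orbit n (l \<zeta>) j) holomorphic_on UNIV"
          unfolding l_def by (rule holomorphic_on_Scomp)
        show "continuous_on UNIV ?u"
          by (intro continuous_intros contn)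
        show "cmod (orbit n (l \<zeta>) j) \<le> exp (?u \<zeta>)" for \<zeta>
          unfolding exp_u by (rule cmod_le_supnorm1[OF that])
      qed
      \<comment> \<open>The truncation at 1 in \<open>supnorm1\<close> has to be bounded as well as
        the coordinates.\<close>
      moreover have "0 \<le> M n"
        unfolding M_def by (intro divide_nonneg_nonneg integral_nonneg integrable_continuous_real circ contn) auto
      ultimately have "exp (?u w) \<le> exp (real d ^ n * M n)"
        unfolding exp_u using k by (subst supnorm1_le_iff) auto
      then show ?thesis
        using d by simp
    qed
    moreover have "M \<longlonglongrightarrow> integral {0..2*pi} (\<lambda>t. green (l (w + of_real r * cis t))) / (2*pi)"
      unfolding M_def
    proof (intro tendsto_intros)
      show "(\<lambda>n. integral {0..2*pi} (\<lambda>t. pot n (l (w + of_real r * cis t))))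
          \<longlonglongrightarrow> integral {0..2*pi} (\<lambda>t. green (l (w + of_real r * cis t)))"
      proof (rule dominated_convergence(2))
        show "(\<lambda>t. pot n (l (w + of_real r * cis t))) integrable_on {0..2*pi}" for n
          by (intro integrable_continuous_real circ contn)
        \<comment> \<open>The corrected potentials decrease in \<open>n\<close>, so the one at time
          0 dominates all of them.\<close>
        show "(\<lambda>t. pot 0 (l (w + of_real r * cis t)) + ln C) integrable_on {0..2*pi}"
          by (intro integrable_continuous_real continuous_intros circ contn)
        show "norm (pot n (l (w + of_real r * cis t))) \<le> pot 0 (l (w + of_real r * cis t)) + ln C" for n t
        proof -
          let ?z = "l (w + of_real r * cis t)"
          have "pot n ?z + ln C / real d ^ n \<le> pot 0 ?z + ln C / real d ^ 0"
            using decseqD[OF decseq_pot, of 0 n ?z] by simp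
          moreover have "0 \<le> ln C / real d ^ n"
            using C_ge by (intro divide_nonneg_nonneg) auto
          ultimately show ?thesis by simp
        qed
      qed (rule pot_tendsto)
    qed simp
    ultimately show ?thesis
      by (intro LIMSEQ_le[OF pot_tendsto]) auto
  qed
  have "usc_on UNIV (\<lambda>\<zeta>. green (l \<zeta>))"
    using cont by (auto simp: usc_on_def continuous_on_def intro: order_tendstoD)
  then show ?thesis
    unfolding subharmonic_def l_def[symmetric]
    using mean by (auto intro!: integrable_continuous_real circ cont)
qed

theorem Ggreen_continuous_nonconstant_psh:
  "continuous_on (Ck k) (Ggreen k d a \<alpha>)
    \<and> (\<exists>z\<in>Ck k. \<exists>w\<in>Ck k. Ggreen k d a \<alpha> z \<noteq> Ggreen k d a \<alpha> w)
    \<and> psh_Ck k (Ggreen k d a \<alpha>)"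
proof (intro conjI)
  show cont: "continuous_on (Ck k) (Ggreen k d a \<alpha>)"
    using continuous_on_subset[OF continuous_on_green, of "Ck k"]
    by (subst continuous_on_cong[OF refl Ggreen_eq_green]) auto
  have zero: "(\<lambda>_. 0) \<in> Ck k"
    by (simp add: Ck_def)
  obtain z where "z \<in> Ck k" "green (\<lambda>_. 0) < green z"
    using green_unbounded by blast
  then show "\<exists>z\<in>Ck k. \<exists>w\<in>Ck k. Ggreen k d a \<alpha> z \<noteq> Ggreen k d a \<alpha> w"
    using zero by (metis Ggreen_eq_green less_irrefl)
  show "psh_Ck k (Ggreen k d a \<alpha>)"
    unfolding psh_Ck_def
  proof (intro conjI ballI)
    show "usc_on (Ck k) (Ggreen k d a \<alpha>)"
      using cont by (auto simp: usc_on_def continuous_on_def intro: order_tendstoD)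
    fix p v assume "p \<in> Ck k" "v \<in> Ck k"
    then have "(\<lambda>j. p j + \<zeta> * v j) \<in> Ck k" for \<zeta>
      by (simp add: Ck_def)
    then show "subharmonic (\<lambda>\<zeta>. Ggreen k d a \<alpha> (\<lambda>j. p j + \<zeta> * v j))"
      using subharmonic_green[of p v] by (simp add: Ggreen_eq_green)
  qed
qed

end

section \<open>Uniform polynomial bounds\<close>

lemma finite_MI_bounded: "finite {i \<in> MI k. mdeg k i \<le> D}"
proof (rule finite_subset)
  show "{i \<in> MI k. mdeg k i \<le> D}
      \<subseteq> {i. \<forall>j. (j \<in> {2..k} \<longrightarrow> i j \<in> {..D}) \<and> (j \<notin> {2..k} \<longrightarrow> i j = 0)}"
  proof safe
    fix i j assume "mdeg k i \<le> D" "j \<in> {2..k}"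
    moreover have "i j \<le> mdeg k i" if "j \<in> {2..k}"
      unfolding mdeg_def using that by (intro member_le_sum) auto
    ultimately show "i j \<le> D"
      by (meson order.trans)
  qed (auto simp: MI_def)
  show "finite {i :: nat \<Rightarrow> nat. \<forall>j. (j \<in> {2..k} \<longrightarrow> i j \<in> {..D}) \<and> (j \<notin> {2..k} \<longrightarrow> i j = 0)}"
    by (rule finite_set_of_finite_funs) auto
qed

lemma cmod_monom_le:
  assumes "1 \<le> r" "\<And>j. j \<in> {2..k} \<Longrightarrow> cmod (z j) \<le> r" "mdeg k i \<le> D"
  shows "cmod (monom k i z) \<le> r ^ D"
proof -
  have "cmod (monom k i z) \<le> (\<Prod>j\<in>{2..k}. r ^ i j)"
    unfolding monom_def prod_norm[symmetric]
    by (intro prod_mono) (auto simp: norm_power intro!: power_mono assms)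
  also have "\<dots> = r ^ mdeg k i"
    by (simp add: mdeg_def power_sum)
  also have "\<dots> \<le> r ^ D"
    using assms by (intro power_increasing) auto
  finally show ?thesis .
qed

text \<open>The sum is enlarged to all multi-indices of degree at most \<open>D\<close>, so the
  number of terms, and with it the constant, does not depend on \<alpha>.\<close>

lemma cmod_mpoly_le:
  assumes "\<And>i. i \<in> MI k \<Longrightarrow> \<alpha> i \<noteq> 0 \<Longrightarrow> mdeg k i \<le> D" "\<And>i. i \<in> MI k \<Longrightarrow> cmod (\<alpha> i) \<le> M"
    and M: "0 \<le> M" and r: "1 \<le> r" "\<And>j. j \<in> {2..k} \<Longrightarrow> cmod (z j) \<le> r"
  shows "cmod (mpoly k \<alpha> z) \<le> real (card {i \<in> MI k. mdeg k i \<le> D}) * (M * r ^ D)"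
proof -
  have "cmod (mpoly k \<alpha> z) \<le> (\<Sum>i\<in>{i \<in> MI k. \<alpha> i \<noteq> 0}. M * r ^ D)"
    unfolding mpoly_def
    by (intro order.trans[OF norm_sum] sum_mono)
       (auto simp: norm_mult intro!: mult_mono cmod_monom_le assms)
  also have "\<dots> \<le> (\<Sum>i\<in>{i \<in> MI k. mdeg k i \<le> D}. M * r ^ D)"
    using assms by (intro sum_mono2 finite_MI_bounded) auto
  finally show ?thesis by simp
qed

text \<open>Finiteness of the support makes the \<open>Max\<close> in the degree a genuine
  maximum.\<close>

lemma mdeg_le_lin_poly_degree:
  assumes "finite {i \<in> MI k. \<alpha> i \<noteq> 0}" "i \<in> MI k" "\<alpha> i \<noteq> 0"
  shows "mdeg k i \<le> lin_poly_degree k a \<alpha>"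
proof -
  have "{mdeg k i |i. i \<in> MI k \<and> \<alpha> i \<noteq> 0} = mdeg k ` {i \<in> MI k. \<alpha> i \<noteq> 0}"
    by auto
  then show ?thesis
    unfolding lin_poly_degree_def using assms by (intro Max_ge) auto
qed

theorem theorem3p8:
  fixes k d dt :: nat
    and a :: "nat \<Rightarrow> complex"
    and \<alpha> :: "nat \<Rightarrow> (nat \<Rightarrow> nat) \<Rightarrow> complex"
    and mt Mt :: real
  assumes "k \<ge> 3"
    and "dt \<ge> 1" and "d \<ge> dt + 2"
    and "mt > 0" and "Mt > 0"
    and "\<forall>n\<ge>1. mt < cmod (a n) \<and> cmod (a n) < Mt"
    and "\<forall>n\<ge>1. finite {i\<in>MI k. \<alpha> n i \<noteq> 0}"
    and "\<forall>n\<ge>1. \<forall>i\<in>MI k. cmod (\<alpha> n i) < Mt"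
    and "\<forall>n\<ge>1. lin_poly_degree k (a n) (\<alpha> n) = dt"
  shows "continuous_on (Ck k) (Ggreen k d a \<alpha>)
    \<and> (\<exists>z\<in>Ck k. \<exists>w\<in>Ck k. Ggreen k d a \<alpha> z \<noteq> Ggreen k d a \<alpha> w)
    \<and> psh_Ck k (Ggreen k d a \<alpha>)"
proof -
  define K where "K = real (card {i \<in> MI k. mdeg k i \<le> dt})"
  have K: "0 \<le> K"
    by (simp add: K_def)
  have "cmod (a n * z 1 + mpoly k (\<alpha> n) z) \<le> (Mt + K * Mt) * r ^ (d - 2)"
    if n: "1 \<le> n" and r: "1 \<le> r" and z: "\<And>j. j \<in> {1..k} \<Longrightarrow> cmod (z j) \<le> r" for n z r
  proof -
    \<comment> \<open>Since \<open>1 \<le> dt\<close> and \<open>dt + 2 \<le> d\<close>, both the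
      linear term and the polynomial have order at most \<open>d - 2\<close>.\<close>
    have dd: "r \<le> r ^ (d - 2)" "r ^ dt \<le> r ^ (d - 2)"
      using assms(2,3) r by (auto intro!: power_increasing self_le_power)
    have "cmod (a n * z 1) \<le> Mt * r ^ (d - 2)"
      unfolding norm_mult using assms n dd r
      by (intro mult_mono order.trans[OF z]) (auto simp: less_imp_le)
    moreover have "cmod (mpoly k (\<alpha> n) z) \<le> K * (Mt * r ^ dt)"
      unfolding K_def using assms n r z mdeg_le_lin_poly_degree[of k "\<alpha> n" _ "a n"]
      by (intro cmod_mpoly_le) (auto simp: less_imp_le)
    moreover have "K * (Mt * r ^ dt) \<le> K * (Mt * r ^ (d - 2))"
      using K dd assms by (intro mult_left_mono) auto
    ultimately show ?thesis
      using norm_triangle_ineq[of "a n * z 1" "mpoly k (\<alpha> n) z"] by (simp add: algebra_simps)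
  qed
  then interpret perturbed_shifts k d a \<alpha> "Mt + K * Mt"
    using assms K by unfold_locales auto
  show ?thesis
    by (rule Ggreen_continuous_nonconstant_psh)
qed

end
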